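(* Let $\alpha,\lambda\in(0,\infty)$ and $\beta\in[0,1)$, let $X\sim\mathrm{TS}(\alpha,\beta,\lambda)$ be a one-sided tempered stable process, and let $\kappa_1,\kappa_2,\kappa_3$ be the first three cumulants of $X_1$. Then the parameters $\alpha,\beta,\lambda$ are given by $$\beta=1-\frac{\kappa_2^2}{\kappa_1\kappa_3-\kappa_2^2},\qquad\lambda=(1-\beta)\frac{\kappa_1}{\kappa_2},\qquad\alpha=\frac{\lambda^{1-\beta}}{\Gamma(1-\beta)}\kappa_1.$$
   Context: For $\alpha,\lambda\in(0,\infty)$ and $\beta\in[0,1)$, the one-sided tempered stable distribution $\mathrm{TS}(\alpha,\beta,\lambda)$ is the infinitely divisible distribution on $\mathbb{R}$ with characteristic function $\varphi(z)=\exp\big(\int_{\mathbb{R}}(e^{izx}-1)F(dx)\big)$, $z\in\mathbb{R}$, where $F(dx)=\frac{\alpha}{x^{1+\beta}}e^{-\lambda x}\mathbf{1}_{(0,\infty)}(x)\,dx$. A one-sided tempered stable process $X\sim\mathrm{TS}(\alpha,\beta,\lambda)$ is a Lévy process such that $X_1$ has this distribution. The cumulants are $\kappa_n=\frac{d^n}{dz^n}\ln\mathbb{E}[e^{zX_1}]\big|_{z=0}$; in terms of the moments $m_j=\mathbb{E}[X_1^j]$ they are $\kappa_1=m_1$, $\kappa_2=m_2-m_1^2$, $\kappa_3=m_3-3m_1m_2+2m_1^3$. $\Gamma$ is the Gamma function. *)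

theory Defs
  imports "HOL-Probability.Probability"
begin

text \<open>Time runs through the nonnegative reals; \<open>X t\<close> is irrelevant for \<open>t < 0\<close>.\<close>

locale levy_process = prob_space M
  for M :: "'a measure" and X :: "real \<Rightarrow> 'a \<Rightarrow> real" +
  assumes random_variable_X: "\<And>t. 0 \<le> t \<Longrightarrow> random_variable borel (X t)"
    and start_zero: "AE \<omega> in M. X 0 \<omega> = 0"
    and indep_increments:
      "\<And>(t :: nat \<Rightarrow> real) n. 0 \<le> t 0 \<Longrightarrow> (\<And>i. i < n \<Longrightarrow> t i \<le> t (Suc i)) \<Longrightarrow>
         indep_vars (\<lambda>_. borel) (\<lambda>i \<omega>. X (t (Suc i)) \<omega> - X (t i) \<omega>) {..<n}"
    and stationary_increments:
      "\<And>s t. 0 \<le> s \<Longrightarrow> s \<le> t \<Longrightarrow>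
         distr M borel (\<lambda>\<omega>. X t \<omega> - X s \<omega>) = distr M borel (X (t - s))"
    and stochastically_continuous:
      "\<And>t \<epsilon>. 0 \<le> t \<Longrightarrow> 0 < \<epsilon> \<Longrightarrow>
         ((\<lambda>s. prob {\<omega> \<in> space M. \<bar>X s \<omega> - X t \<omega>\<bar> > \<epsilon>}) \<longlongrightarrow> 0) (at t within {0..})"
    and cadlag_paths:
      "AE \<omega> in M.
         (\<forall>t\<ge>0. ((\<lambda>s. X s \<omega>) \<longlongrightarrow> X t \<omega>) (at_right t)) \<and>
         (\<forall>t>0. \<exists>l. ((\<lambda>s. X s \<omega>) \<longlongrightarrow> l) (at_left t))"

definition infinitely_divisible :: "real measure \<Rightarrow> bool" where
  "infinitely_divisible \<mu> \<longleftrightarrow>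
     (\<forall>n\<ge>1. \<exists>\<nu>. real_distribution \<nu> \<and> ((\<lambda>\<rho>. \<rho> \<star> \<nu>) ^^ n) (return borel 0) = \<mu>)"

definition TS_levy_measure :: "real \<Rightarrow> real \<Rightarrow> real \<Rightarrow> real measure" where
  "TS_levy_measure \<alpha> \<beta> l =
     density lborel (\<lambda>x. ennreal (\<alpha> / x powr (1 + \<beta>) * exp (- l * x) * indicator {0<..} x))"

text \<open>
  A distribution on the real line is determined by its characteristic function, so at most
  one \<open>\<mu>\<close> satisfies this predicate. For \<open>0 \<le> \<beta> < 1\<close> the integrand below is
  Bochner integrable: its norm is at most \<open>\<bar>z * x\<bar>\<close>, which has finite integral.
\<close>

definition tempered_stable :: "real \<Rightarrow> real \<Rightarrow> real \<Rightarrow> real measure \<Rightarrow> bool" where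
  "tempered_stable \<alpha> \<beta> l \<mu> \<longleftrightarrow>
     real_distribution \<mu> \<and> infinitely_divisible \<mu> \<and>
     (\<forall>z. char \<mu> z = exp (\<integral>x. (iexp (z * x) - 1) \<partial>TS_levy_measure \<alpha> \<beta> l))"

definition TS_process ::
    "real \<Rightarrow> real \<Rightarrow> real \<Rightarrow> 'a measure \<Rightarrow> (real \<Rightarrow> 'a \<Rightarrow> real) \<Rightarrow> bool" where
  "TS_process \<alpha> \<beta> l M X \<longleftrightarrow>
     levy_process M X \<and> tempered_stable \<alpha> \<beta> l (distr M borel (X 1))"

definition cumulant :: "'a measure \<Rightarrow> ('a \<Rightarrow> real) \<Rightarrow> nat \<Rightarrow> real" where
  "cumulant M Y n = (deriv ^^ n) (\<lambda>z :: real. ln (\<integral>\<omega>. exp (z * Y \<omega>) \<partial>M)) 0"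

end

theory Submission
  imports Defs
begin

text \<open>
  The hypotheses describe the characteristic function, whereas cumulants involve the moment
  generating function, so the main point is to pass from the imaginary to the real axis. The law
  is a weak limit of sums of \<open>n\<close> independent variables, each distributed as roughly \<open>F / n\<close> away
  from an atom at \<open>0\<close>. For every complex \<open>w\<close> in a strip around the imaginary axis, the expectations
  of \<open>exp (w * x)\<close> under these sums tend to \<open>exp (\<integral>x. exp (w * x) - 1 \<partial>F)\<close>. For imaginary \<open>w\<close> this
  identifies the weak limit, by Levy's continuity theorem; for real \<open>w\<close> it identifies the moment
  generating function, since the bound at \<open>2 * w\<close> gives uniform integrability at \<open>w\<close>.
  Differentiating under the integral sign, the derivative of the logarithm of the moment generating
  function at \<open>s\<close> is a Gamma integral, equal to \<open>\<alpha> * Gamma (1 - \<beta>) * (l - s) powr (\<beta> - 1)\<close>, and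
  the three cumulants are its value and first two derivatives at \<open>0\<close>.
\<close>

section \<open>Complex exponentials: a Lipschitz bound and the compound interest limit\<close>

text \<open>The mean value inequality on a half-plane, which is convex and where the derivative
  \<open>exp u\<close> has norm \<open>exp (Re u)\<close>, hence at most
  \<open>exp r\<close>.\<close>

lemma norm_exp_diff_le:
  fixes w z :: complex
  assumes "Re w \<le> r" "Re z \<le> r"
  shows "norm (exp w - exp z) \<le> exp r * norm (w - z)"
proof (rule field_differentiable_bound)
  show "convex {u. Re u \<le> r}" by (rule convex_halfspace_Re_le)
  show "(exp has_field_derivative exp u) (at u within {u. Re u \<le> r})" for u :: complex
    by (auto intro!: derivative_eq_intros)
qed (use assms in auto)

text \<open>The power is \<open>exp (n * Ln (1 + h))\<close> with \<open>h = a n / n\<close>.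
  Replacing the logarithm by \<open>h\<close> changes the exponent by at most a multiple of
  \<open>n * norm h ^ 2 = norm (a n) * norm h\<close>, which vanishes because \<open>a\<close>
  converges.\<close>

lemma tendsto_exp_limit_sequence:
  fixes a :: "nat \<Rightarrow> complex"
  assumes a: "a \<longlonglongrightarrow> L"
  shows "(\<lambda>n. (1 + a n / of_nat n) ^ n) \<longlonglongrightarrow> exp L"
proof -
  define h where "h n = a n / of_nat n" for n
  have h: "h \<longlonglongrightarrow> 0"
    unfolding h_def by (rule tendsto_divide_0[OF a tendsto_of_nat])
  \<comment> \<open>The bound 1/2 keeps both \<open>1 - norm (h n)\<close>, the denominator in the
    logarithm estimate, and \<open>1 + h n\<close> away from 0; \<open>n > 0\<close> gives
    \<open>of_nat n * h n = a n\<close>.\<close>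
  have ev: "\<forall>\<^sub>F n in sequentially. norm (h n) < 1/2 \<and> n > 0"
    using order_tendstoD(2)[OF tendsto_norm[OF h], of "1/2"] eventually_gt_at_top[of 0]
    by (auto elim: eventually_conj)
  have lim0: "(\<lambda>n. of_nat n * (Ln (1 + h n) - h n)) \<longlonglongrightarrow> 0"
  proof (rule Lim_null_comparison)
    show "\<forall>\<^sub>F n in sequentially. norm (of_nat n * (Ln (1 + h n) - h n)) \<le> 2 * norm (a n) * norm (h n)"
      using ev
    proof eventually_elim
      case (elim n)
      then have "norm (Ln (1 + h n) - h n) \<le> (norm (h n))\<^sup>2 / (1 - norm (h n))"
        by (intro Ln_approx_linear) auto
      also have "\<dots> \<le> (norm (h n))\<^sup>2 / (1 / 2)"
        using elim by (intro divide_left_mono) auto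
      finally have "norm (of_nat n * (Ln (1 + h n) - h n)) \<le> real n * (2 * (norm (h n))\<^sup>2)"
        by (simp add: norm_mult mult_left_mono)
      also have "\<dots> = 2 * norm (a n) * norm (h n)"
        using elim by (simp add: h_def norm_divide power2_eq_square)
      finally show ?case .
    qed
    show "(\<lambda>n. 2 * norm (a n) * norm (h n)) \<longlonglongrightarrow> 0"
      using tendsto_mult[OF tendsto_mult[OF tendsto_const[of 2] tendsto_norm[OF a]] tendsto_norm[OF h]]
      by simp
  qed
  have "(\<lambda>n. exp (a n + of_nat n * (Ln (1 + h n) - h n))) \<longlonglongrightarrow> exp L"
    using tendsto_add[OF a lim0] by (intro tendsto_exp) simp
  moreover have "\<forall>\<^sub>F n in sequentially.
      exp (a n + of_nat n * (Ln (1 + h n) - h n)) = (1 + a n / of_nat n) ^ n"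
    using ev
  proof eventually_elim
    case (elim n)
    have "1 + h n \<noteq> 0"
    proof
      assume "1 + h n = 0"
      then have "h n = -1" by (simp add: eq_neg_iff_add_eq_0 add.commute)
      then show False using elim by simp
    qed
    have "a n + of_nat n * (Ln (1 + h n) - h n) = of_nat n * Ln (1 + h n)"
      using elim by (simp add: h_def right_diff_distrib)
    then show ?case
      using \<open>1 + h n \<noteq> 0\<close> by (simp add: exp_of_nat_mult flip: h_def)
  qed
  ultimately show ?thesis by (rule Lim_transform_eventually)
qed

section \<open>Filling up a subprobability measure by an atom at 0\<close>

text \<open>The missing mass is placed at 0; as \<open>G\<close> does not charge 0, deleting that
  atom recovers \<open>G\<close>. Applied to a thinned multiple of \<open>F\<close>, this yields the
  law of a single summand.\<close>

lemma exists_prob_completion_at_0: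
  fixes G :: "real measure"
  assumes "subprob_space G" and sets_G[measurable_cong]: "sets G = sets borel" and G0: "emeasure G {0} = 0"
  shows "\<exists>\<nu>. real_distribution \<nu> \<and> density \<nu> (indicator (-{0})) = G"
proof -
  interpret G: subprob_space G by fact
  \<comment> \<open>The sum of two measures is written as a bind over the counting measure on
    \<open>bool\<close>, whose values select \<open>G\<close> and the atom.\<close>
  define N where
    "N b = (if b then G else density (return borel 0) (\<lambda>_. 1 - emeasure G UNIV))" for b
  define \<nu> where "\<nu> = count_space UNIV \<bind> N"
  have sp: "space G = UNIV" using sets_eq_imp_space_eq[OF sets_G] by simp
  have le: "emeasure G UNIV \<le> 1" using G.emeasure_space_le_1 sp by simp
  have "subprob_space (density (return borel (0::real)) (\<lambda>_. 1 - emeasure G UNIV))"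
    by (rule subprob_spaceI) (auto simp: emeasure_density nn_integral_return)
  then have "N \<in> measurable (count_space UNIV) (subprob_algebra borel)"
    using \<open>subprob_space G\<close> by (auto simp: N_def space_subprob_algebra sets_G)
  then have em: "emeasure \<nu> A = emeasure G A + (1 - emeasure G UNIV) * indicator A 0"
    if "A \<in> sets borel" for A
    using that
    by (simp add: \<nu>_def emeasure_bind N_def nn_integral_count_space_finite UNIV_bool
        emeasure_density nn_integral_cmult)
  have sets_\<nu>[measurable_cong, simp]: "sets \<nu> = sets borel"
    unfolding \<nu>_def by (rule sets_bind) (auto simp: N_def sets_G)
  have sp\<nu>: "space \<nu> = UNIV" using sets_eq_imp_space_eq[OF sets_\<nu>] by simp
  have "prob_space \<nu>"
    by (rule prob_spaceI) (use le in \<open>simp add: sp\<nu> em\<close>)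
  moreover have "density \<nu> (indicator (-{0})) = G"
  proof (rule measure_eqI)
    fix A assume "A \<in> sets (density \<nu> (indicator (-{0})))"
    then have [measurable]: "A \<in> sets borel" by simp
    have "emeasure (density \<nu> (indicator (-{0}))) A = emeasure \<nu> (A - {0})"
      by (subst emeasure_density)
         (auto simp flip: nn_integral_indicator intro!: nn_integral_cong split: split_indicator)
    also have "\<dots> = emeasure G (A - {0})" by (simp add: em)
    also have "\<dots> = emeasure G A"
      by (rule emeasure_Diff_null_set) (auto simp: null_sets_def G0)
    finally show "emeasure (density \<nu> (indicator (-{0}))) A = emeasure G A" .
  qed (simp add: sets_G)
  ultimately show ?thesis
    by (auto simp: real_distribution_def real_distribution_axioms_def sp\<nu> intro!: exI[of _ \<nu>])
qed

text \<open>The atom has weight one minus the mass of \<open>G\<close>, and subtracting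
  \<open>f 0\<close> under the integral accounts for it. For an exponential \<open>f\<close> the
  result has the form 1 plus a correction, ready for an \<open>n\<close>-th power limit.\<close>

lemma integral_prob_completion_at_0:
  fixes f :: "real \<Rightarrow> 'b::{real_normed_field, banach, second_countable_topology}"
  assumes "real_distribution \<nu>" and G: "density \<nu> (indicator (-{0})) = G"
    and f: "integrable G f"
  shows "integrable \<nu> f" and "(\<integral>x. f x \<partial>\<nu>) = f 0 + (\<integral>x. f x - f 0 \<partial>G)"
proof -
  interpret real_distribution \<nu> by fact
  have f_meas[measurable]: "f \<in> borel_measurable borel"
    using f unfolding G[symmetric] by (auto dest!: borel_measurable_integrable simp: measurable_def)
  have G': "G = density \<nu> (\<lambda>x. ennreal (indicator (-{0}) x))"
    by (simp add: G[symmetric] ennreal_indicator)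
  have I: "integrable \<nu> (\<lambda>x. indicator (-{0}) x *\<^sub>R f x)"
    using f unfolding G' by (subst (asm) integrable_density) auto
  have I0: "integrable \<nu> (\<lambda>x. indicator {0} x *\<^sub>R f 0)"
    by (intro integrable_scaleR_left) (auto simp: less_top[symmetric])
  have split: "f = (\<lambda>x. indicator {0} x *\<^sub>R f 0 + indicator (-{0}) x *\<^sub>R f x)"
    by (auto simp: fun_eq_iff split: split_indicator)
  show "integrable \<nu> f"
    by (subst split) (intro Bochner_Integration.integrable_add I I0)
  have mG: "measure G (space G) = prob (-{0})"
    by (simp add: G' measure_def emeasure_density ennreal_indicator)
  have "finite_measure G"
    by (rule finite_measureI) (simp add: G' emeasure_density ennreal_indicator)
  then interpret G: finite_measure G .
  have "(\<integral>x. f x \<partial>\<nu>) = prob {0} *\<^sub>R f 0 + (\<integral>x. indicator (-{0}) x *\<^sub>R f x \<partial>\<nu>)"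
    by (subst split, subst Bochner_Integration.integral_add[OF I0 I])
       (simp add: less_top[symmetric])
  also have "(\<integral>x. indicator (-{0}) x *\<^sub>R f x \<partial>\<nu>) = (\<integral>x. f x \<partial>G)"
    unfolding G' by (rule integral_density[symmetric]) auto
  also have "prob {0} = 1 - measure G (space G)"
    using prob_compl[of "{0}"] by (simp add: mG Compl_eq_Diff_UNIV)
  finally show "(\<integral>x. f x \<partial>\<nu>) = f 0 + (\<integral>x. f x - f 0 \<partial>G)"
    using f by (simp add: algebra_simps)
qed

section \<open>Sums of independent variables approximating the law with exponent
  \<open>F\<close>\<close>

text \<open>The convolution power is taken as the image of a product measure, so that expectations
  of exponentials factor over the coordinates.\<close>

definition iid_sum :: "real measure \<Rightarrow> nat \<Rightarrow> real measure" where
  "iid_sum \<nu> m = distr (\<Pi>\<^sub>M i\<in>{..<m}. \<nu>) borel (\<lambda>\<omega>. \<Sum>i<m. \<omega> i)"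

lemma real_distribution_iid_sum:
  assumes "real_distribution \<nu>"
  shows "real_distribution (iid_sum \<nu> m)"
proof -
  interpret real_distribution \<nu> by fact
  interpret P: prob_space "\<Pi>\<^sub>M i\<in>{..<m}. \<nu>"
    by (intro prob_space_PiM prob_space_axioms)
  show ?thesis
    unfolding iid_sum_def by (intro P.real_distribution_distr) measurable
qed

lemma
  fixes w :: complex
  assumes "real_distribution \<nu>" and int: "integrable \<nu> (\<lambda>x. exp (w * of_real x))"
  shows integrable_exp_iid_sum: "integrable (iid_sum \<nu> m) (\<lambda>x. exp (w * of_real x))"
    and integral_exp_iid_sum:
      "(\<integral>x. exp (w * of_real x) \<partial>iid_sum \<nu> m) = (\<integral>x. exp (w * of_real x) \<partial>\<nu>) ^ m"
proof -
  interpret real_distribution \<nu> by fact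
  interpret product_sigma_finite "\<lambda>_::nat. \<nu>" ..
  have exp_sum: "exp (w * (\<Sum>i<m. of_real (\<omega> i))) = (\<Prod>i<m. exp (w * of_real (\<omega> i)))" for \<omega> :: "nat \<Rightarrow> real"
    by (simp add: sum_distrib_left exp_sum)
  show "integrable (iid_sum \<nu> m) (\<lambda>x. exp (w * of_real x))"
    unfolding iid_sum_def
    by (subst integrable_distr_eq) (auto simp: exp_sum intro!: product_integrable_prod int)
  show "(\<integral>x. exp (w * of_real x) \<partial>iid_sum \<nu> m) = (\<integral>x. exp (w * of_real x) \<partial>\<nu>) ^ m"
    unfolding iid_sum_def
    by (subst integral_distr)
       (auto simp: exp_sum product_integral_prod[where I="{..<m}" and f="\<lambda>_ x. exp (w * of_real x)", OF _ int])
qed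

text \<open>Both exponents have real part at most \<open>a * \<bar>x\<bar>\<close>, so the Lipschitz
  bound applies. The factor \<open>\<bar>x\<bar> * exp (a * \<bar>x\<bar>)\<close> is the dominating
  function for the limits under the integral.\<close>

lemma norm_exp_mult_diff_le:
  fixes w z :: complex and x :: real
  assumes "\<bar>Re w\<bar> \<le> a" "\<bar>Re z\<bar> \<le> a"
  shows "norm (exp (w * of_real x) - exp (z * of_real x)) \<le> norm (w - z) * (\<bar>x\<bar> * exp (a * \<bar>x\<bar>))"
proof -
  have Re_le: "Re (u * of_real x) \<le> a * \<bar>x\<bar>" if "\<bar>Re u\<bar> \<le> a" for u
  proof -
    have "Re u * x \<le> \<bar>Re u\<bar> * \<bar>x\<bar>"
      by (metis abs_ge_self abs_mult)
    also have "\<dots> \<le> a * \<bar>x\<bar>"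
      using that by (intro mult_right_mono) auto
    finally show ?thesis by simp
  qed
  have "norm (exp (w * of_real x) - exp (z * of_real x))
      \<le> exp (a * \<bar>x\<bar>) * norm (w * of_real x - z * of_real x)"
    by (intro norm_exp_diff_le Re_le assms)
  also have "\<dots> = norm (w - z) * (\<bar>x\<bar> * exp (a * \<bar>x\<bar>))"
    by (simp add: norm_mult flip: left_diff_distrib)
  finally show ?thesis .
qed

lemma norm_exp_minus_one_le:
  fixes w :: complex and x :: real
  assumes "\<bar>Re w\<bar> \<le> a"
  shows "norm (exp (w * of_real x) - 1) \<le> norm w * (\<bar>x\<bar> * exp (a * \<bar>x\<bar>))"
  using norm_exp_mult_diff_le[of w a 0 x] assms by simp

text \<open>For \<open>n > 0\<close> a summand has transform \<open>1 + A w n / n\<close>, where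
  \<open>A w n\<close> tends to the integral of \<open>exp (w * x) - 1\<close> under
  \<open>F\<close>; the \<open>n\<close>-th power then tends to the exponential. One sequence serves
  the whole strip, which links its two axes.\<close>

lemma exists_approximating_iid_sums:
  fixes F :: "real measure" and a :: real
  assumes sets_F[measurable_cong]: "sets F = sets borel"
    and F: "integrable F (\<lambda>x. \<bar>x\<bar> * exp (a * \<bar>x\<bar>))" and a: "0 \<le> a"
  obtains \<mu> where "\<And>n. real_distribution (\<mu> n)"
    and "\<And>n w. \<bar>Re w\<bar> \<le> a \<Longrightarrow> integrable (\<mu> n) (\<lambda>x. exp (w * of_real x))"
    and "\<And>w. \<bar>Re w\<bar> \<le> a \<Longrightarrow> (\<lambda>n. \<integral>x. exp (w * of_real x) \<partial>\<mu> n)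
           \<longlonglongrightarrow> exp (\<integral>x. exp (w * of_real x) - 1 \<partial>F)"
proof -
  have F1: "integrable F (\<lambda>x. \<bar>x\<bar>)"
    by (rule Bochner_Integration.integrable_bound[OF F])
       (use a in \<open>auto simp: abs_mult mult_le_cancel_left1\<close>)
  \<comment> \<open>Adding 1 makes \<open>c\<close> positive even when the integral
    vanishes.\<close>
  define c where "c = 1 + (\<integral>x. \<bar>x\<bar> \<partial>F)"
  have c: "c > 0" "(\<integral>x. \<bar>x\<bar> \<partial>F) \<le> c"
    unfolding c_def by (auto intro!: add_pos_nonneg)
  define p where "p n x = min (1 / real n) (\<bar>x\<bar> / c)" for n x
  \<comment> \<open>\<open>G n\<close> is \<open>F / n\<close> thinned out near \<open>0\<close>, where \<open>F\<close> may have infinite mass: the cap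
    \<open>\<bar>x\<bar> / c\<close> keeps the total mass below 1 and becomes inactive as \<open>n\<close> grows.\<close>
  define G where "G n = density F (\<lambda>x. ennreal (p n x))" for n
  have p_meas[measurable]: "p n \<in> borel_measurable borel" for n
    unfolding p_def by measurable
  \<comment> \<open>Index 0 is included: \<open>1 / 0 = 0\<close> makes \<open>p 0\<close> vanish,
    so \<open>G 0\<close> is the null measure.\<close>
  have p0: "0 \<le> p n x" for n x using c by (simp add: p_def)
  have G: "subprob_space (G n)" for n
  proof (rule subprob_spaceI)
    have "emeasure (G n) (space (G n)) = (\<integral>\<^sup>+x. ennreal (p n x) \<partial>F)"
      by (auto simp: G_def emeasure_density intro!: nn_integral_cong)
    also have "\<dots> \<le> (\<integral>\<^sup>+x. ennreal (\<bar>x\<bar> / c) \<partial>F)"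
      by (intro nn_integral_mono ennreal_leI) (simp add: p_def)
    also have "\<dots> = ennreal ((\<integral>x. \<bar>x\<bar> \<partial>F) / c)"
      using c F1 by (subst nn_integral_eq_integral) auto
    also have "\<dots> \<le> 1" using c by (simp add: ennreal_le_1)
    finally show "emeasure (G n) (space (G n)) \<le> 1" .
  qed (use sets_eq_imp_space_eq[OF sets_F] in \<open>simp add: G_def\<close>)
  \<comment> \<open>The cap gives \<open>p n 0 = 0\<close>, so a possible atom of \<open>F\<close>
    at 0 disappears.\<close>
  have G0: "emeasure (G n) {0} = 0" for n
  proof -
    have "emeasure (G n) {0} = (\<integral>\<^sup>+x. 0 \<partial>F)"
      unfolding G_def
      by (subst emeasure_density) (auto intro!: nn_integral_cong simp: p_def split: split_indicator)
    then show ?thesis by simp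
  qed
  have "\<forall>n. \<exists>\<nu>. real_distribution \<nu> \<and> density \<nu> (indicator (-{0})) = G n"
    using exists_prob_completion_at_0[OF G _ G0] by (simp add: G_def sets_F)
  then obtain \<nu> where \<nu>: "\<And>n. real_distribution (\<nu> n)"
    and \<nu>G: "\<And>n. density (\<nu> n) (indicator (-{0})) = G n" by metis
  have int_G: "integrable (G n) (\<lambda>x. exp (w * of_real x) - 1)" if "\<bar>Re w\<bar> \<le> a" for n w
    unfolding G_def
  proof (subst integrable_density)
    show "integrable F (\<lambda>x. p n x *\<^sub>R (exp (w * of_real x) - 1))"
    proof (rule Bochner_Integration.integrable_bound)
      show "integrable F (\<lambda>x. 1 / real n * (norm w * (\<bar>x\<bar> * exp (a * \<bar>x\<bar>))))"
        using F by simp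
      show "AE x in F. norm (p n x *\<^sub>R (exp (w * of_real x) - 1))
          \<le> norm (1 / real n * (norm w * (\<bar>x\<bar> * exp (a * \<bar>x\<bar>))))"
      proof (intro AE_I2)
        fix x
        have "p n x * norm (exp (w * of_real x) - 1) \<le> 1 / real n * (norm w * (\<bar>x\<bar> * exp (a * \<bar>x\<bar>)))"
          using p0[of n x] norm_exp_minus_one_le[OF that, of x]
          by (intro mult_mono) (auto simp: p_def)
        then show "norm (p n x *\<^sub>R (exp (w * of_real x) - 1))
          \<le> norm (1 / real n * (norm w * (\<bar>x\<bar> * exp (a * \<bar>x\<bar>))))"
          using p0[of n x] by (simp add: abs_mult)
      qed
    qed measurable
  qed (use p0 in auto)
  have int_G': "integrable (G n) (\<lambda>x. exp (w * of_real x))" if "\<bar>Re w\<bar> \<le> a" for n w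
  proof -
    interpret subprob_space "G n" by (rule G)
    have "integrable (G n) (\<lambda>x. (exp (w * of_real x) - 1) + 1)"
      by (intro Bochner_Integration.integrable_add int_G that) simp
    then show ?thesis by simp
  qed
  have int_\<nu>: "integrable (\<nu> n) (\<lambda>x. exp (w * of_real x))"
    and integral_\<nu>: "(\<integral>x. exp (w * of_real x) \<partial>\<nu> n) = 1 + (\<integral>x. exp (w * of_real x) - 1 \<partial>G n)"
    if "\<bar>Re w\<bar> \<le> a" for n w
    using integral_prob_completion_at_0[OF \<nu> \<nu>G int_G'[OF that]] by simp_all
  \<comment> \<open>For \<open>n > 0\<close> this is \<open>n\<close> times the integral under
    \<open>G n\<close>. The weight lies between 0 and 1, so dominated convergence applies.\<close>
  define A where "A w n = (\<integral>x. min 1 (real n * \<bar>x\<bar> / c) *\<^sub>R (exp (w * of_real x) - 1) \<partial>F)"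
    for w :: complex and n
  have A: "A w \<longlonglongrightarrow> (\<integral>x. exp (w * of_real x) - 1 \<partial>F)" if "\<bar>Re w\<bar> \<le> a" for w
    unfolding A_def
  proof (rule integral_dominated_convergence)
    show "integrable F (\<lambda>x. norm w * (\<bar>x\<bar> * exp (a * \<bar>x\<bar>)))" using F by simp
    show "AE x in F. norm (min 1 (real n * \<bar>x\<bar> / c) *\<^sub>R (exp (w * of_real x) - 1))
        \<le> norm w * (\<bar>x\<bar> * exp (a * \<bar>x\<bar>))" for n
    proof (intro AE_I2)
      fix x
      have "\<bar>min 1 (real n * \<bar>x\<bar> / c)\<bar> * norm (exp (w * of_real x) - 1)
          \<le> 1 * (norm w * (\<bar>x\<bar> * exp (a * \<bar>x\<bar>)))"
        using c norm_exp_minus_one_le[OF that, of x] by (intro mult_mono) auto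
      then show "norm (min 1 (real n * \<bar>x\<bar> / c) *\<^sub>R (exp (w * of_real x) - 1))
          \<le> norm w * (\<bar>x\<bar> * exp (a * \<bar>x\<bar>))" by simp
    qed
    show "AE x in F. (\<lambda>n. min 1 (real n * \<bar>x\<bar> / c) *\<^sub>R (exp (w * of_real x) - 1))
        \<longlonglongrightarrow> exp (w * of_real x) - 1"
    proof (intro AE_I2)
      fix x :: real
      \<comment> \<open>At \<open>x = 0\<close> the integrand is 0 for every \<open>n\<close>;
        elsewhere the weight equals 1 from some index on.\<close>
      show "(\<lambda>n. min 1 (real n * \<bar>x\<bar> / c) *\<^sub>R (exp (w * of_real x) - 1)) \<longlonglongrightarrow> exp (w * of_real x) - 1"
      proof (cases "x = 0")
        case False
        obtain N :: nat where "c / \<bar>x\<bar> < real N" using reals_Archimedean2 by blast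
        then have "1 \<le> real n * \<bar>x\<bar> / c" if "n \<ge> N" for n
        proof -
          have "c < real N * \<bar>x\<bar>"
            using \<open>c / \<bar>x\<bar> < real N\<close> False by (simp add: pos_divide_less_eq)
          also have "\<dots> \<le> real n * \<bar>x\<bar>"
            using that by (intro mult_right_mono) auto
          finally show ?thesis using c by simp
        qed
        then have "\<forall>\<^sub>F n in sequentially. min 1 (real n * \<bar>x\<bar> / c) *\<^sub>R (exp (w * of_real x) - 1)
            = exp (w * of_real x) - 1"
          by (auto simp: eventually_sequentially intro!: exI[of _ N])
        then show ?thesis by (rule tendsto_eventually)
      qed simp
    qed
  qed (measurable)
  have AG: "(\<integral>x. exp (w * of_real x) - 1 \<partial>G n) = A w n / of_nat n" if "n > 0" for w n
  proof -
    have "(\<integral>x. exp (w * of_real x) - 1 \<partial>G n) = (\<integral>x. p n x *\<^sub>R (exp (w * of_real x) - 1) \<partial>F)"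
      unfolding G_def by (rule integral_density) (use p0 in auto)
    also have "\<dots> = (\<integral>x. (1 / real n) *\<^sub>R (min 1 (real n * \<bar>x\<bar> / c) *\<^sub>R (exp (w * of_real x) - 1)) \<partial>F)"
    proof (intro Bochner_Integration.integral_cong refl)
      fix x
      have "p n x = 1 / real n * min 1 (real n * \<bar>x\<bar> / c)"
        using that by (simp add: p_def min_mult_distrib_left)
      then show "p n x *\<^sub>R (exp (w * of_real x) - 1)
          = (1 / real n) *\<^sub>R (min 1 (real n * \<bar>x\<bar> / c) *\<^sub>R (exp (w * of_real x) - 1))"
        by simp
    qed
    also have "\<dots> = A w n / of_nat n"
      unfolding A_def by (simp add: scaleR_conv_of_real)
    finally show ?thesis .
  qed
  show thesis
  proof (rule that[of "\<lambda>n. iid_sum (\<nu> n) n"])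
    fix w assume w: "\<bar>Re w\<bar> \<le> a"
    have "\<forall>\<^sub>F n in sequentially.
        (\<integral>x. exp (w * of_real x) \<partial>iid_sum (\<nu> n) n) = (1 + A w n / of_nat n) ^ n"
      using eventually_gt_at_top[of 0]
      by eventually_elim (simp add: integral_exp_iid_sum[OF \<nu> int_\<nu>[OF w]] integral_\<nu>[OF w] AG)
    then show "(\<lambda>n. \<integral>x. exp (w * of_real x) \<partial>iid_sum (\<nu> n) n)
        \<longlonglongrightarrow> exp (\<integral>x. exp (w * of_real x) - 1 \<partial>F)"
      using tendsto_exp_limit_sequence[OF A[OF w]] by (simp cong: tendsto_cong)
  qed (auto intro!: real_distribution_iid_sum integrable_exp_iid_sum \<nu> int_\<nu>)
qed

section \<open>Passing expectations of unbounded functions to a weak limit\<close>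

text \<open>Truncation at height \<open>K\<close> makes \<open>f\<close> bounded and continuous, so
  weak convergence applies to it; the bounded second moments make the truncation error at most
  \<open>B / K\<close>, uniformly in \<open>n\<close>.\<close>

lemma integral_weak_limit_of_L2_bounded:
  fixes f :: "real \<Rightarrow> real"
  assumes M: "\<And>n. real_distribution (M n)" and \<mu>: "real_distribution \<mu>"
    and conv: "weak_conv_m M \<mu>"
    and f: "continuous_on UNIV f" "\<And>x. 0 \<le> f x"
    and int: "\<And>n. integrable (M n) f" and int2: "\<And>n. integrable (M n) (\<lambda>x. (f x)\<^sup>2)"
    and B: "\<And>n. (\<integral>x. (f x)\<^sup>2 \<partial>M n) \<le> B"
    and L: "(\<lambda>n. \<integral>x. f x \<partial>M n) \<longlonglongrightarrow> L"
  shows "(\<integral>x. f x \<partial>\<mu>) = L"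
proof -
  interpret \<mu>: real_distribution \<mu> by fact
  interpret M: real_distribution "M n" for n by fact
  define g where "g K x = min (f x) (real K)" for K x
  have f_meas[measurable]: "f \<in> borel_measurable borel"
    using f(1) by (rule borel_measurable_continuous_onI)
  have g_meas[measurable]: "g K \<in> borel_measurable borel" for K
    unfolding g_def by measurable
  have g_bound: "norm (g K x) \<le> real K" for K x
    using f(2)[of x] by (simp add: g_def)
  have g_le: "g K x \<le> f x" for K x by (simp add: g_def)
  have g_int: "integrable (M n) (g K)" "integrable \<mu> (g K)" for n K
    using g_bound
    by (auto intro!: M.integrable_const_bound[where B="real K"] \<mu>.integrable_const_bound[where B="real K"])
  have g_conv: "(\<lambda>n. \<integral>x. g K x \<partial>M n) \<longlonglongrightarrow> (\<integral>x. g K x \<partial>\<mu>)" for K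
  proof (rule weak_conv_imp_integral_bdd_continuous_conv[OF M \<mu> conv])
    show "isCont (g K) x" for x
      unfolding g_def using f(1) by (auto intro!: continuous_min simp: continuous_on_eq_continuous_at)
  qed (rule g_bound)
  have tail: "(\<integral>x. f x \<partial>M n) - (\<integral>x. g K x \<partial>M n) \<le> B / real K" if "K > 0" for K n
  proof -
    \<comment> \<open>The left side vanishes unless \<open>f x > K\<close>, and there
      \<open>f x \<le> (f x)^2 / K\<close>.\<close>
    have "f x - g K x \<le> (f x)\<^sup>2 / real K" for x
    proof (cases "f x \<le> real K")
      case False
      then have "f x * real K \<le> (f x)\<^sup>2"
        using f(2)[of x] unfolding power2_eq_square by (intro mult_left_mono) auto
      then have "f x \<le> (f x)\<^sup>2 / real K"
        using that by (simp add: pos_le_divide_eq)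
      with False show ?thesis by (simp add: g_def)
    qed (simp add: g_def)
    then have "(\<integral>x. f x - g K x \<partial>M n) \<le> (\<integral>x. (f x)\<^sup>2 / real K \<partial>M n)"
      by (intro integral_mono Bochner_Integration.integrable_diff int g_int) (use int2 in auto)
    also have "\<dots> \<le> B / real K"
      using B[of n] by (simp add: divide_right_mono)
    finally show ?thesis
      by (simp add: Bochner_Integration.integral_diff int g_int)
  qed
  have lower: "L - B / real K \<le> (\<integral>x. g K x \<partial>\<mu>)" if "K > 0" for K
    using LIMSEQ_le_const2[OF tendsto_diff[OF L g_conv[of K]], of "B / real K"] tail[OF that]
    by (auto simp: algebra_simps)
  have upper: "(\<integral>x. g K x \<partial>\<mu>) \<le> L" for K
    by (rule LIMSEQ_le[OF g_conv L]) (auto intro!: integral_mono g_int int g_le)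
  have lim: "(\<lambda>K. \<integral>x. g K x \<partial>\<mu>) \<longlonglongrightarrow> L"
  proof (rule tendsto_sandwich)
    show "\<forall>\<^sub>F K in sequentially. L - B / real K \<le> (\<integral>x. g K x \<partial>\<mu>)"
      using eventually_gt_at_top[of 0] by eventually_elim (rule lower)
    show "(\<lambda>K. L - B / real K) \<longlonglongrightarrow> L"
      using tendsto_diff[OF tendsto_const lim_const_over_n, of L B] by simp
  qed (use upper in auto)
  \<comment> \<open>Convergence in \<open>K\<close> is monotone; this suits a limit law under which
    integrability of \<open>f\<close> is not yet known.\<close>
  have mono: "AE x in \<mu>. mono (\<lambda>K. g K x)"
    by (auto simp: g_def mono_def)
  have ptw: "AE x in \<mu>. (\<lambda>K. g K x) \<longlonglongrightarrow> f x"
  proof (intro AE_I2 tendsto_eventually)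
    fix x
    show "\<forall>\<^sub>F K in sequentially. g K x = f x"
      using eventually_ge_at_top[of "nat \<lceil>f x\<rceil>"]
    proof eventually_elim
      case (elim K)
      then have "f x \<le> real K"
        using real_nat_ceiling_ge[of "f x"] by linarith
      then show ?case by (simp add: g_def)
    qed
  qed
  show "(\<integral>x. f x \<partial>\<mu>) = L"
    by (rule integral_monotone_convergence[OF g_int(2) mono ptw lim]) simp
qed

text \<open>The factor 2 in the bound on \<open>s\<close> arises because the square of
  \<open>exp (s * x)\<close> is \<open>exp (2 * s * x)\<close>: the second moments are transforms at
  \<open>2 * s\<close>, which converge and hence stay bounded.\<close>

lemma mgf_levy_khintchine:
  fixes F \<mu> :: "real measure" and a s :: real
  assumes sets_F: "sets F = sets borel"
    and F: "integrable F (\<lambda>x. \<bar>x\<bar> * exp (a * \<bar>x\<bar>))"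
    and \<mu>: "real_distribution \<mu>"
    and char: "\<And>z. char \<mu> z = exp (\<integral>x. iexp (z * x) - 1 \<partial>F)"
    and s: "2 * \<bar>s\<bar> \<le> a"
  shows "(\<integral>x. exp (s * x) \<partial>\<mu>) = exp (\<integral>x. exp (s * x) - 1 \<partial>F)"
proof -
  have a: "0 \<le> a" using s by linarith
  obtain M where M: "\<And>n. real_distribution (M n)"
    and int: "\<And>n w. \<bar>Re w\<bar> \<le> a \<Longrightarrow> integrable (M n) (\<lambda>x. exp (w * of_real x))"
    and lim: "\<And>w. \<bar>Re w\<bar> \<le> a \<Longrightarrow> (\<lambda>n. \<integral>x. exp (w * of_real x) \<partial>M n)
           \<longlonglongrightarrow> exp (\<integral>x. exp (w * of_real x) - 1 \<partial>F)"
    using exists_approximating_iid_sums[OF sets_F F a] by blast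
  have weak: "weak_conv_m M \<mu>"
  proof (rule levy_continuity[OF M \<mu>])
    fix t
    show "(\<lambda>n. char (M n) t) \<longlonglongrightarrow> char \<mu> t"
      \<comment> \<open>The point \<open>\<i> * t\<close> has real part 0, so it lies in the strip
        for every \<open>t\<close>.\<close>
      unfolding char using lim[of "\<i> * of_real t"] a by (simp add: char_def mult.assoc)
  qed
  have exp_real: "exp (of_real r * of_real x) = complex_of_real (exp (r * x))" for r x
    by (simp flip: exp_of_real)
  have int_real: "integrable (M n) (\<lambda>x. exp (r * x))" if "\<bar>r\<bar> \<le> a" for n r
    using int[of "of_real r" n] that by (simp add: exp_real complex_of_real_integrable_eq)
  have lim_real: "(\<lambda>n. \<integral>x. exp (r * x) \<partial>M n) \<longlonglongrightarrow> exp (\<integral>x. exp (r * x) - 1 \<partial>F)"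
    if "\<bar>r\<bar> \<le> a" for r
  proof -
    have "exp (of_real r * of_real x) - 1 = complex_of_real (exp (r * x) - 1)" for x
      by (simp add: exp_real)
    then have "(\<lambda>n. complex_of_real (\<integral>x. exp (r * x) \<partial>M n))
        \<longlonglongrightarrow> of_real (exp (\<integral>x. exp (r * x) - 1 \<partial>F))"
      using lim[of "of_real r"] that
      by (simp only: exp_real integral_complex_of_real Re_complex_of_real exp_of_real)
    then show ?thesis by (simp only: tendsto_of_real_iff)
  qed
  have "convergent (\<lambda>n. \<integral>x. exp (2 * s * x) \<partial>M n)"
    using lim_real[of "2 * s"] s by (auto simp: convergent_def abs_mult)
  then obtain B where "\<And>n. norm (\<integral>x. exp (2 * s * x) \<partial>M n) \<le> B"
    using convergent_imp_Bseq BseqE by metis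
  then have B: "(\<integral>x. (exp (s * x))\<^sup>2 \<partial>M n) \<le> B" for n
    by (simp add: exp_double[symmetric] mult.assoc)
  have *: "integrable (M n) (\<lambda>x. (exp (s * x))\<^sup>2)" for n
    using int_real[of "2 * s" n] s by (simp add: exp_double[symmetric] mult.assoc abs_mult)
  show ?thesis
    by (rule integral_weak_limit_of_L2_bounded[OF M \<mu> weak _ _ int_real * B lim_real])
       (use s in \<open>auto intro!: continuous_intros\<close>)
qed

section \<open>Differentiating the exponent under the integral sign\<close>

lemma has_derivative_integral_exp_minus_one:
  fixes F :: "real measure" and a s :: real
  assumes sets_F[measurable_cong]: "sets F = sets borel"
    and F: "integrable F (\<lambda>x. \<bar>x\<bar> * exp (a * \<bar>x\<bar>))"
    and s: "\<bar>s\<bar> < a"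
  shows "((\<lambda>s. \<integral>x. exp (s * x) - 1 \<partial>F) has_real_derivative (\<integral>x. x * exp (s * x) \<partial>F)) (at s)"
proof -
  have bound: "\<bar>exp (r * x) - exp (t * x)\<bar> \<le> \<bar>r - t\<bar> * (\<bar>x\<bar> * exp (a * \<bar>x\<bar>))"
    if "\<bar>r\<bar> \<le> a" "\<bar>t\<bar> \<le> a" for r t x
    using norm_exp_mult_diff_le[of "of_real r" a "of_real t" x] that
    by (simp add: exp_of_real flip: of_real_diff of_real_mult)
  have int: "integrable F (\<lambda>x. exp (r * x) - 1)" if "\<bar>r\<bar> \<le> a" for r
  proof (rule Bochner_Integration.integrable_bound)
    show "integrable F (\<lambda>x. \<bar>r\<bar> * (\<bar>x\<bar> * exp (a * \<bar>x\<bar>)))" using F by simp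
    show "AE x in F. norm (exp (r * x) - 1) \<le> norm (\<bar>r\<bar> * (\<bar>x\<bar> * exp (a * \<bar>x\<bar>)))"
      using bound[of r 0] that by (auto simp: abs_mult)
  qed measurable
  have ev: "\<forall>\<^sub>F t in at s. \<bar>t\<bar> \<le> a \<and> t \<noteq> s"
  proof -
    have "\<forall>\<^sub>F t in nhds s. t \<in> {-a<..<a}"
      using s by (intro eventually_nhds_in_open) auto
    then show ?thesis unfolding eventually_at_filter by eventually_elim auto
  qed
  have "((\<lambda>t. \<integral>x. (exp (t * x) - exp (s * x)) / (t - s) \<partial>F) \<longlongrightarrow> (\<integral>x. x * exp (s * x) \<partial>F)) (at s)"
  proof (subst tendsto_at_iff_sequentially, intro allI impI)
    fix X :: "nat \<Rightarrow> real"
    assume X: "\<forall>n. X n \<in> UNIV - {s}" "X \<longlonglongrightarrow> s"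
    have X': "filterlim X (at s) sequentially"
      using X by (auto simp: filterlim_at)
    have "\<forall>\<^sub>F n in sequentially. \<bar>X n\<bar> \<le> a \<and> X n \<noteq> s"
      using ev X' by (auto simp: filterlim_iff)
    \<comment> \<open>Domination must hold at every index, so the sequence is shifted until all its
      terms lie in the strip.\<close>
    then obtain N where N: "\<And>n. n \<ge> N \<Longrightarrow> \<bar>X n\<bar> \<le> a \<and> X n \<noteq> s"
      by (auto simp: eventually_sequentially)
    have "(\<lambda>n. \<integral>x. (exp (X (n + N) * x) - exp (s * x)) / (X (n + N) - s) \<partial>F)
        \<longlonglongrightarrow> (\<integral>x. x * exp (s * x) \<partial>F)"
    proof (rule integral_dominated_convergence[OF _ _ F])
      show "AE x in F. norm ((exp (X (n + N) * x) - exp (s * x)) / (X (n + N) - s)) \<le> \<bar>x\<bar> * exp (a * \<bar>x\<bar>)" for n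
        using bound[of "X (n + N)" s] N[of "n + N"] s by (auto simp: pos_divide_le_eq mult.commute)
      show "AE x in F. (\<lambda>n. (exp (X (n + N) * x) - exp (s * x)) / (X (n + N) - s)) \<longlonglongrightarrow> x * exp (s * x)"
      proof (intro AE_I2)
        fix x
        have "((\<lambda>t. exp (t * x)) has_real_derivative x * exp (s * x)) (at s)"
          by (auto intro!: derivative_eq_intros)
        then have "((\<lambda>t. (exp (t * x) - exp (s * x)) / (t - s)) \<longlongrightarrow> x * exp (s * x)) (at s)"
          by (simp add: has_field_derivative_iff)
        from filterlim_compose[OF this X']
        show "(\<lambda>n. (exp (X (n + N) * x) - exp (s * x)) / (X (n + N) - s)) \<longlonglongrightarrow> x * exp (s * x)"
          by (rule LIMSEQ_ignore_initial_segment)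
      qed
    qed measurable
    then show "((\<lambda>t. \<integral>x. (exp (t * x) - exp (s * x)) / (t - s) \<partial>F) \<circ> X) \<longlonglongrightarrow> (\<integral>x. x * exp (s * x) \<partial>F)"
      unfolding comp_def by (rule LIMSEQ_offset)
  qed
  moreover have "\<forall>\<^sub>F t in at s. (\<integral>x. (exp (t * x) - exp (s * x)) / (t - s) \<partial>F)
      = ((\<integral>x. exp (t * x) - 1 \<partial>F) - (\<integral>x. exp (s * x) - 1 \<partial>F)) / (t - s)"
    using ev
  proof eventually_elim
    case (elim t)
    have "(\<integral>x. exp (t * x) - 1 \<partial>F) - (\<integral>x. exp (s * x) - 1 \<partial>F)
        = (\<integral>x. (exp (t * x) - 1) - (exp (s * x) - 1) \<partial>F)"
      using elim s by (intro Bochner_Integration.integral_diff[symmetric] int) auto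
    then show ?case by simp
  qed
  ultimately show ?thesis
    unfolding has_field_derivative_iff by (rule Lim_transform_eventually)
qed

section \<open>Gamma integrals and the tempered stable law\<close>

text \<open>Substitute \<open>t = c * x\<close> in Euler's integral. With nonnegative integrals, the
  finite value later yields integrability as well.\<close>

lemma nn_integral_Gamma_rate:
  fixes s c :: real
  assumes s: "s > 0" and c: "c > 0"
  shows "(\<integral>\<^sup>+x. ennreal (indicator {0..} x * x powr (s - 1) * exp (- (c * x))) \<partial>lborel)
    = ennreal (Gamma s / c powr s)"
    (is "?I = _")
proof -
  have "ennreal (Gamma s) = (\<integral>\<^sup>+t. ennreal (indicator {0..} t * t powr (s - 1) / exp t) \<partial>lborel)"
    by (rule Gamma_conv_nn_integral_real[OF s])
  also have "\<dots> = ennreal c * (\<integral>\<^sup>+x. ennreal (indicator {0..} (c * x) * (c * x) powr (s - 1) / exp (c * x)) \<partial>lborel)"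
    using c by (subst nn_integral_real_affine[where c=c and t=0]) auto
  also have "(\<integral>\<^sup>+x. ennreal (indicator {0..} (c * x) * (c * x) powr (s - 1) / exp (c * x)) \<partial>lborel)
      = (\<integral>\<^sup>+x. ennreal (c powr (s - 1)) * ennreal (indicator {0..} x * x powr (s - 1) * exp (- (c * x))) \<partial>lborel)"
    using c by (intro nn_integral_cong)
      (auto simp: powr_mult exp_minus divide_inverse zero_le_mult_iff mult_ac
        simp flip: ennreal_mult' split: split_indicator)
  also have "\<dots> = ennreal (c powr (s - 1)) * ?I"
    by (rule nn_integral_cmult) measurable
  also have "ennreal c * (ennreal (c powr (s - 1)) * ?I) = ennreal (c powr s) * ?I"
    using c by (simp add: powr_diff mult.assoc[symmetric] flip: ennreal_mult')
  finally have *: "ennreal (Gamma s) = ennreal (c powr s) * ?I" .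
  have "?I = ennreal (1 / c powr s) * (ennreal (c powr s) * ?I)"
    using c by (simp add: mult.assoc[symmetric] flip: ennreal_mult')
  also have "\<dots> = ennreal (Gamma s / c powr s)"
    using c by (simp flip: * ennreal_mult')
  finally show ?thesis .
qed

lemma sets_TS_levy_measure [simp, measurable_cong]: "sets (TS_levy_measure \<alpha> \<beta> l) = sets borel"
  by (simp add: TS_levy_measure_def)

lemma AE_TS_levy_measure_pos: "AE x in TS_levy_measure \<alpha> \<beta> l. 0 < x"
  unfolding TS_levy_measure_def by (subst AE_density) (auto split: split_indicator)

text \<open>The factor \<open>x\<close> lowers the singularity \<open>x powr (- 1 - \<beta>)\<close>
  to \<open>x powr (- \<beta>)\<close>, leaving a Gamma integral of shape \<open>1 - \<beta>\<close>
  and rate \<open>l - r\<close>.\<close>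

lemma
  assumes "\<alpha> > 0" "\<beta> < 1" "r < l"
  shows integrable_TS_levy_measure: "integrable (TS_levy_measure \<alpha> \<beta> l) (\<lambda>x. x * exp (r * x))"
    and integral_TS_levy_measure: "(\<integral>x. x * exp (r * x) \<partial>TS_levy_measure \<alpha> \<beta> l)
      = \<alpha> * Gamma (1 - \<beta>) * (l - r) powr (\<beta> - 1)"
proof -
  let ?F = "TS_levy_measure \<alpha> \<beta> l"
  have "(\<integral>\<^sup>+x. ennreal (x * exp (r * x)) \<partial>?F)
      = (\<integral>\<^sup>+x. ennreal (\<alpha> / x powr (1 + \<beta>) * exp (- l * x) * indicator {0<..} x)
          * ennreal (x * exp (r * x)) \<partial>lborel)"
    unfolding TS_levy_measure_def by (rule nn_integral_density) measurable
  also have "\<dots> = (\<integral>\<^sup>+x. ennreal \<alpha> * ennreal (indicator {0..} x * x powr ((1 - \<beta>) - 1) * exp (- ((l - r) * x))) \<partial>lborel)"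
  proof (intro nn_integral_cong)
    fix x :: real
    \<comment> \<open>The half-lines \<open>{0<..}\<close> and \<open>{0..}\<close> differ at 0,
      where the right side vanishes too because \<open>0 powr y = 0\<close>.\<close>
    show "ennreal (\<alpha> / x powr (1 + \<beta>) * exp (- l * x) * indicator {0<..} x) * ennreal (x * exp (r * x))
      = ennreal \<alpha> * ennreal (indicator {0..} x * x powr ((1 - \<beta>) - 1) * exp (- ((l - r) * x)))"
    proof (cases "x > 0")
      case True
      have "x / x powr (1 + \<beta>) = x powr (- \<beta>)"
        using True by (simp add: powr_add powr_minus divide_inverse)
      moreover have "exp (- (l * x)) * exp (r * x) = exp (- ((l - r) * x))"
        by (simp add: exp_add[symmetric] algebra_simps)
      ultimately have "\<alpha> / x powr (1 + \<beta>) * exp (- l * x) * (x * exp (r * x))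
          = \<alpha> * (x powr (- \<beta>) * exp (- ((l - r) * x)))"
        by (metis (no_types, lifting) mult.assoc mult.commute mult_minus_left times_divide_eq_left)
      then show ?thesis
        using True assms(1) by (simp flip: ennreal_mult')
    qed (auto split: split_indicator)
  qed
  also have "\<dots> = ennreal \<alpha> * ennreal (Gamma (1 - \<beta>) / (l - r) powr (1 - \<beta>))"
    using assms nn_integral_Gamma_rate[of "1 - \<beta>" "l - r"] by (subst nn_integral_cmult) auto
  also have "\<dots> = ennreal (\<alpha> * Gamma (1 - \<beta>) * (l - r) powr (\<beta> - 1))"
    using assms powr_minus_divide[of "l - r" "1 - \<beta>"] by (simp flip: ennreal_mult')
  finally have nn: "(\<integral>\<^sup>+x. ennreal (x * exp (r * x)) \<partial>?F)
      = ennreal (\<alpha> * Gamma (1 - \<beta>) * (l - r) powr (\<beta> - 1))" .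
  have nonneg: "AE x in ?F. 0 \<le> x * exp (r * x)"
    using AE_TS_levy_measure_pos by eventually_elim simp
  have "has_bochner_integral ?F (\<lambda>x. x * exp (r * x)) (\<alpha> * Gamma (1 - \<beta>) * (l - r) powr (\<beta> - 1))"
    using assms Gamma_real_pos[of "1 - \<beta>"]
    by (intro has_bochner_integral_nn_integral nn nonneg) auto
  then show "integrable ?F (\<lambda>x. x * exp (r * x))"
    and "(\<integral>x. x * exp (r * x) \<partial>?F) = \<alpha> * Gamma (1 - \<beta>) * (l - r) powr (\<beta> - 1)"
    by (auto simp: has_bochner_integral_iff)
qed

text \<open>The strip has half-width \<open>l / 2\<close>, below the exponential decay rate
  \<open>l\<close>; halving it again to \<open>l / 4\<close> leaves room for
  \<open>2 * s\<close>.\<close>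

lemma has_derivative_ln_mgf_tempered_stable:
  assumes "tempered_stable \<alpha> \<beta> l \<mu>" "\<alpha> > 0" "\<beta> < 1" "l > 0" "\<bar>s\<bar> < l / 4"
  shows "((\<lambda>s. ln (\<integral>x. exp (s * x) \<partial>\<mu>)) has_real_derivative
    \<alpha> * Gamma (1 - \<beta>) * (l - s) powr (\<beta> - 1)) (at s)"
proof -
  let ?F = "TS_levy_measure \<alpha> \<beta> l"
  have \<mu>: "real_distribution \<mu>" and char: "\<And>z. char \<mu> z = exp (\<integral>x. iexp (z * x) - 1 \<partial>?F)"
    using assms(1) by (auto simp: tempered_stable_def)
  have "integrable ?F (\<lambda>x. x * exp (l / 2 * x))"
    by (rule integrable_TS_levy_measure) (use assms in auto)
  then have F: "integrable ?F (\<lambda>x. \<bar>x\<bar> * exp (l / 2 * \<bar>x\<bar>))"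
    by (rule integrable_cong_AE_imp)
       (use AE_TS_levy_measure_pos[of \<alpha> \<beta> l] in \<open>auto elim!: eventually_mono\<close>)
  have "((\<lambda>s. \<integral>x. exp (s * x) - 1 \<partial>?F) has_real_derivative
      \<alpha> * Gamma (1 - \<beta>) * (l - s) powr (\<beta> - 1)) (at s)"
    using has_derivative_integral_exp_minus_one[OF sets_TS_levy_measure F, of s]
      integral_TS_levy_measure[of \<alpha> \<beta> s l] assms by simp
  then show ?thesis
  proof (rule has_field_derivative_transform_within_open)
    show "open {-(l/4)<..<l/4}" "s \<in> {-(l/4)<..<l/4}" using assms by auto
    show "(\<integral>x. exp (t * x) - 1 \<partial>?F) = ln (\<integral>x. exp (t * x) \<partial>\<mu>)" if "t \<in> {-(l/4)<..<l/4}" for t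
      using mgf_levy_khintchine[OF sets_TS_levy_measure F \<mu> char, of t] that by (simp add: abs_if)
  qed
qed

section \<open>The cumulants and their inversion\<close>

text \<open>Derivatives are local: a formula valid on an open set can be differentiated again, which
  gives the higher derivatives one by one.\<close>

lemma deriv_eq_on_open:
  fixes f f' :: "real \<Rightarrow> real"
  assumes "open S" "\<And>x. x \<in> S \<Longrightarrow> f x = g x"
    "\<And>x. x \<in> S \<Longrightarrow> (g has_real_derivative g' x) (at x)" "x \<in> S"
  shows "deriv f x = g' x"
  using assms by (intro DERIV_imp_deriv has_field_derivative_transform_within_open[of g "g' x" x S f]) auto

theorem proposition5p4:
  fixes M :: "'a measure" and X :: "real \<Rightarrow> 'a \<Rightarrow> real"
    and \<alpha> \<beta> l \<kappa>1 \<kappa>2 \<kappa>3 :: real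
  assumes "\<alpha> > 0" and "l > 0" and "0 \<le> \<beta>" and "\<beta> < 1"
    and "TS_process \<alpha> \<beta> l M X"
    and "\<kappa>1 = cumulant M (X 1) 1"
    and "\<kappa>2 = cumulant M (X 1) 2"
    and "\<kappa>3 = cumulant M (X 1) 3"
  shows "\<beta> = 1 - \<kappa>2\<^sup>2 / (\<kappa>1 * \<kappa>3 - \<kappa>2\<^sup>2) \<and>
         l = (1 - \<beta>) * (\<kappa>1 / \<kappa>2) \<and>
         \<alpha> = l powr (1 - \<beta>) / Gamma (1 - \<beta>) * \<kappa>1"
proof -
  interpret levy_process M X using assms(5) by (simp add: TS_process_def)
  have [measurable]: "X 1 \<in> borel_measurable M" by (rule random_variable_X) simp
  have ts: "tempered_stable \<alpha> \<beta> l (distr M borel (X 1))"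
    using assms(5) by (simp add: TS_process_def)
  define f where "f z = ln (\<integral>\<omega>. exp (z * X 1 \<omega>) \<partial>M)" for z :: real
  have f_eq: "f = (\<lambda>z. ln (\<integral>x. exp (z * x) \<partial>distr M borel (X 1)))"
    by (auto simp: f_def integral_distr)
  define A where "A = \<alpha> * Gamma (1 - \<beta>)"
  have A: "A > 0" using assms by (simp add: A_def Gamma_real_pos)
  define S where "S = {-(l/4)<..<l/4}"
  have S: "open S" "0 \<in> S" "\<And>z. z \<in> S \<Longrightarrow> z < l" "\<And>z. z \<in> S \<Longrightarrow> \<bar>z\<bar> < l / 4"
    using assms by (auto simp: S_def)
  have d1: "deriv f z = A * (l - z) powr (\<beta> - 1)" if "z \<in> S" for z
    unfolding f_eq A_def
    using that assms S by (intro DERIV_imp_deriv has_derivative_ln_mgf_tempered_stable[OF ts]) auto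
  have d2: "deriv (deriv f) z = A * (1 - \<beta>) * (l - z) powr (\<beta> - 2)" if "z \<in> S" for z
    by (rule deriv_eq_on_open[OF S(1) d1 _ that])
       (auto intro!: derivative_eq_intros dest: S(3) simp: algebra_simps)
  have d3: "deriv (deriv (deriv f)) z = A * (1 - \<beta>) * (2 - \<beta>) * (l - z) powr (\<beta> - 3)" if "z \<in> S" for z
    by (rule deriv_eq_on_open[OF S(1) d2 _ that])
       (auto intro!: derivative_eq_intros dest: S(3) simp: algebra_simps)
  \<comment> \<open>\<open>P\<close> is the first cumulant; the next two derivatives at 0 contribute
    the factors \<open>(1 - \<beta>) / l\<close> and \<open>(2 - \<beta>) / l\<close>.\<close>
  define P where "P = A * l powr (\<beta> - 1)"
  have P: "P > 0" using A assms by (simp add: P_def)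
  have powr2: "l powr (\<beta> - 2) = l powr (\<beta> - 1) / l" and powr3: "l powr (\<beta> - 3) = l powr (\<beta> - 1) / l\<^sup>2"
    using assms powr_diff[of l "\<beta> - 1" 1] powr_diff[of l "\<beta> - 1" 2] by (auto simp: powr_numeral)
  have \<kappa>1: "\<kappa>1 = P"
    using assms(6) d1[OF S(2)] by (simp add: cumulant_def P_def flip: f_def)
  have \<kappa>2: "\<kappa>2 = P * (1 - \<beta>) / l"
    using assms(7) d2[OF S(2)] by (simp add: cumulant_def P_def numeral_2_eq_2 powr2 flip: f_def)
  have \<kappa>3: "\<kappa>3 = P * (1 - \<beta>) * (2 - \<beta>) / l\<^sup>2"
    using assms(8) d3[OF S(2)] by (simp add: cumulant_def P_def numeral_3_eq_3 powr3 flip: f_def)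
  \<comment> \<open>The common factor \<open>P^2 * (1 - \<beta>) / l^2\<close> is multiplied by
    \<open>(2 - \<beta>) - (1 - \<beta>) = 1\<close>.\<close>
  have "\<kappa>1 * \<kappa>3 - \<kappa>2\<^sup>2 = P\<^sup>2 * (1 - \<beta>) / l\<^sup>2"
    unfolding \<kappa>1 \<kappa>2 \<kappa>3 using assms by (simp add: field_simps power2_eq_square)
  then have "\<kappa>2\<^sup>2 / (\<kappa>1 * \<kappa>3 - \<kappa>2\<^sup>2) = 1 - \<beta>"
    unfolding \<kappa>2 using assms P by (simp add: power_divide power_mult_distrib) (simp add: power2_eq_square)
  moreover have "l = (1 - \<beta>) * (\<kappa>1 / \<kappa>2)"
    unfolding \<kappa>1 \<kappa>2 using assms P by simp
  moreover have "\<alpha> = l powr (1 - \<beta>) / Gamma (1 - \<beta>) * \<kappa>1"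
  proof -
    have "l powr (1 - \<beta>) * l powr (\<beta> - 1) = 1"
      using assms by (simp flip: powr_add)
    then have "l powr (1 - \<beta>) * P = A" unfolding P_def by (metis mult.left_commute mult.right_neutral)
    moreover have "Gamma (1 - \<beta>) > 0"
      using \<open>\<beta> < 1\<close> by (intro Gamma_real_pos) simp
    ultimately show ?thesis
      by (simp add: \<kappa>1 A_def)
  qed
  ultimately show ?thesis by simp
qed

end
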